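(* Let $m\geq 2$ be an even natural number. Then for each integer $j$ with $0\leq j\leq \frac{m-2}{2}$, $$(-1)^{\frac{m}{2}+j-1}\left[-\binom{m-1}{2j-1}+\sum_{k=0}^{\frac{m}{2}-j-1}\left[\binom{m-1}{2k+2j}\binom{m-1}{2k+1}-\binom{m-1}{2k}\binom{m-1}{2k+2j-1}\right]\right]=\binom{m-1}{j+\frac{m}{2}-1},$$ and moreover (an identity not involving $j$) $$(-1)^{\frac{m}{2}}\left(1-m+\sum_{k=0}^{\frac{m}{2}-2}\binom{m-1}{2k+1}\left[\binom{m-1}{2k+2}-\binom{m-1}{2k}\right]\right)=\binom{m-1}{\frac{m}{2}}.$$
   Context: $\binom{a}{b}$ denotes the usual binomial coefficient, with the standard convention $\binom{a}{b}=0$ when $b<0$ (so $\binom{m-1}{-1}=0$, which occurs when $j=0$). An empty sum (as occurs in the second identity when $m=2$) is equal to $0$. *)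

theory Defs
  imports Complex_Main
begin

text \<open>Binomial coefficient with an integer lower index; it vanishes when the lower index is negative.\<close>

definition binom :: "nat \<Rightarrow> int \<Rightarrow> int" where
  "binom a b = (if b < 0 then 0 else int (a choose nat b))"

end

theory Submission
  imports Defs "HOL-Computational_Algebra.Polynomial"
begin

text \<open>
  After the symmetry \<open>binom n b = binom n (n - b)\<close> of one factor, the summands
  \<open>binom (m - 1) (2 * k + 2 * j) * binom (m - 1) (2 * k + 1)\<close> become the even-indexed terms, and
  \<open>binom (m - 1) (2 * k) * binom (m - 1) (2 * k + 2 * j - 1)\<close> together with the isolated
  \<open>binom (m - 1) (2 * j - 1)\<close> (the case \<open>k = m div 2 - j\<close>) the odd-indexed terms, of the coefficient of
  \<open>x ^ (m - 2 + 2 * j)\<close> in \<open>(1 - x) ^ (m - 1) * (1 + x) ^ (m - 1) = (1 - x\<^sup>2) ^ (m - 1)\<close>.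
  The second identity is the first one for \<open>j = 1\<close>, whose proof only needs \<open>j \<le> m div 2\<close>.
\<close>

text \<open>Multiplication by \<open>monom c d\<close> shifts coefficients by \<open>d\<close>, so
  the induction step is Pascal's rule.\<close>

lemma coeff_one_plus_monom_power:
  fixes c :: "'a :: comm_ring_1"
  assumes "d > 0"
  shows "coeff ((1 + monom c d) ^ n) (d * i) = of_nat (n choose i) * c ^ i"
proof (induction n arbitrary: i)
  case 0
  show ?case
    using assms by (cases i) auto
next
  case (Suc n)
  show ?case
  proof (cases i)
    case 0
    with Suc.IH[of 0] assms show ?thesis
      by (simp add: distrib_right coeff_monom_mult)
  next
    case (Suc i')
    with Suc.IH[of i] Suc.IH[of i'] show ?thesis
      by (simp add: coeff_monom_mult algebra_simps)
  qed
qed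

lemma alternating_convolution_choose:
  "(\<Sum>i\<le>2 * M. (-1) ^ i * (of_nat (n choose i) * of_nat (n choose (2 * M - i))))
     = (-1) ^ M * (of_nat (n choose M) :: 'a :: comm_ring_1)"
proof -
  let ?p = "\<lambda>c :: 'a. 1 + monom c 1"
  have coeff_p: "coeff (?p c ^ n) i = of_nat (n choose i) * c ^ i" for c i
    using coeff_one_plus_monom_power[of 1 c n i] by simp
  have "(\<Sum>i\<le>2 * M. (-1) ^ i * (of_nat (n choose i) * of_nat (n choose (2 * M - i))))
      = coeff (?p (-1) ^ n * ?p 1 ^ n) (2 * M)"
    unfolding coeff_mult coeff_p by (simp add: mult_ac)
  also have "?p (-1) ^ n * ?p 1 ^ n = (1 + monom (-1) 2) ^ n"
  proof -
    have "monom (-1) k = - monom (1 :: 'a) k" for k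
      by (simp add: minus_monom)
    then have "?p (-1) * ?p 1 = 1 + monom (-1) 2"
      by (simp add: algebra_simps mult_monom numeral_2_eq_2 del: One_nat_def)
    then show ?thesis
      by (simp only: flip: power_mult_distrib)
  qed
  also have "coeff \<dots> (2 * M) = (-1) ^ M * of_nat (n choose M)"
    by (subst coeff_one_plus_monom_power) (simp_all add: mult.commute)
  finally show ?thesis .
qed

lemma sum_alternating_even_odd:
  fixes f :: "nat \<Rightarrow> 'a :: comm_ring_1"
  shows "(\<Sum>i\<le>2 * M. (-1) ^ i * f i) = (\<Sum>a\<le>M. f (2 * a)) - (\<Sum>a<M. f (2 * a + 1))"
  by (induction M) (simp_all add: lessThan_Suc algebra_simps)

text \<open>The reflection preserves the range from 0 to \<open>n\<close>; outside it both sides are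
  0. Hence no side conditions arise when indices are reflected below.\<close>

lemma binom_symmetric: "binom n b = binom n (int n - b)"
proof (cases "0 \<le> b \<and> b \<le> int n")
  case True
  then show ?thesis
    using binomial_symmetric[of "nat b" n] by (simp add: binom_def nat_diff_distrib nat_le_iff)
qed (auto simp: binom_def binomial_eq_0)

lemma binom_int [simp]: "binom n (int k) = int (n choose k)"
  by (simp add: binom_def)

lemma binom_eq_0: "b < 0 \<or> int n < b \<Longrightarrow> binom n b = 0"
  by (auto simp: binom_def binomial_eq_0)

text \<open>Here \<open>h\<close> stands for \<open>m div 2\<close>. The case
  \<open>h = j = 1\<close>, where the sum is empty, covers \<open>m = 2\<close> in the second
  identity.\<close>

lemma binom_product_sum:
  fixes h j :: nat
  assumes "h \<ge> 1" "j \<le> h"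
  defines "n \<equiv> 2 * h - 1"
  shows "(-1) ^ (h + j - 1) *
           (- binom n (2 * int j - 1) +
            (\<Sum>k = 0..int h - int j - 1.
               binom n (2 * k + 2 * int j) * binom n (2 * k + 1)
               - binom n (2 * k) * binom n (2 * k + 2 * int j - 1)))
         = binom n (int j + int h - 1)"
proof -
  define M where "M = h + j - 1"
  have M: "int M = int h + int j - 1" and n: "int n = 2 * int h - 1"
    using assms by (auto simp: M_def)
  \<comment> \<open>Integer subtraction makes \<open>f (2 * M + 1)\<close> vanish; truncated
    subtraction would give lower index 0.\<close>
  define f where "f i = binom n (int i) * binom n (2 * int M - int i)" for i
  have even_part: "(\<Sum>k = 0..int h - int j - 1. binom n (2 * k + 2 * int j) * binom n (2 * k + 1))
      = (\<Sum>a\<le>M. f (2 * a))"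
  \<comment> \<open>With \<open>a = k + j\<close> the sum covers \<open>j \<le> a < h\<close>.
    Otherwise \<open>f (2 * a) = 0\<close>: for \<open>a \<ge> h\<close> the first lower index
    exceeds \<open>n\<close>, for \<open>a < j\<close> the second does.\<close>
  proof (rule sum.reindex_bij_witness_not_neutral
      [where S' = "{}" and T' = "{a. a \<le> M \<and> (a < j \<or> h \<le> a)}"
         and i = "\<lambda>a. int a - int j" and j = "\<lambda>k. nat (k + int j)"])
    fix a assume "a \<in> {a. a \<le> M \<and> (a < j \<or> h \<le> a)}"
    then have "int n < int (2 * a) \<or> int n < 2 * int M - int (2 * a)"
      using M n by auto
    then show "f (2 * a) = 0"
      by (auto simp: f_def binom_eq_0 simp del: binom_int)
  next
    fix k assume k: "k \<in> {0..int h - int j - 1}"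
    have "binom n (2 * int M - (2 * k + 2 * int j)) = binom n (2 * k + 1)"
      by (subst binom_symmetric) (simp add: M n algebra_simps)
    then show "f (2 * nat (k + int j)) = binom n (2 * k + 2 * int j) * binom n (2 * k + 1)"
      using k by (simp add: f_def del: binom_int)
  qed (use M in auto)
  \<comment> \<open>The range includes \<open>k = h - j\<close> in order to absorb the isolated
    term; the substitution is \<open>a = k + j - 1\<close>.\<close>
  have "(\<Sum>k = 0..int h - int j. binom n (2 * k) * binom n (2 * k + 2 * int j - 1))
      = (\<Sum>a\<le>M. f (2 * a + 1))"
    \<comment> \<open>For \<open>j = 0\<close> the terms \<open>k = 0\<close> and \<open>k = h\<close> vanish; both are sent to \<open>a = M\<close>, where \<open>f (2 * M + 1) = 0\<close>.\<close>
  proof (rule sum.reindex_bij_witness_not_neutral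
      [where S' = "{k. j = 0 \<and> (k = 0 \<or> k = int h)}" and T' = "{a. a \<le> M \<and> (a + 1 < j \<or> h \<le> a \<or> a = M)}"
         and i = "\<lambda>a. int a - int j + 1"
         and j = "\<lambda>k. if k + int j = 0 then M else nat (k + int j - 1)"])
    show "finite {k. j = 0 \<and> (k = 0 \<or> k = int h)}"
      by (rule finite_subset[of _ "{0, int h}"]) auto
  next
    fix a assume "a \<in> {a. a \<le> M \<and> (a + 1 < j \<or> h \<le> a \<or> a = M)}"
    then have "int n < int (2 * a + 1) \<or> int n < 2 * int M - int (2 * a + 1) \<or> 2 * int M - int (2 * a + 1) < 0"
      using M n by auto
    then show "f (2 * a + 1) = 0"
      by (auto simp: f_def binom_eq_0 simp del: binom_int)
  next
    fix k assume k: "k \<in> {0..int h - int j}"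
    show "f (2 * (if k + int j = 0 then M else nat (k + int j - 1)) + 1)
        = binom n (2 * k) * binom n (2 * k + 2 * int j - 1)"
    proof (cases "k + int j = 0")
      case True
      then show ?thesis
        using k by (simp add: f_def binom_eq_0 del: binom_int)
    next
      case False
      then have i: "int (2 * nat (k + int j - 1) + 1) = 2 * k + 2 * int j - 1"
        using k by simp
      have "binom n (2 * int M - (2 * k + 2 * int j - 1)) = binom n (2 * k)"
        by (subst binom_symmetric) (simp add: M n algebra_simps)
      then show ?thesis
        unfolding f_def if_not_P[OF False] i by simp
    qed
  qed (use M n in \<open>auto simp: binom_eq_0\<close>)
  \<comment> \<open>The odd indices up to \<open>2 * M\<close> stop at \<open>a = M - 1\<close>, so
    the term \<open>a = M\<close> has to drop out.\<close>
  moreover have "f (2 * M + 1) = 0"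
    by (simp add: f_def binom_eq_0 del: binom_int)
  ultimately have odd_part:
    "(\<Sum>k = 0..int h - int j. binom n (2 * k) * binom n (2 * k + 2 * int j - 1)) = (\<Sum>a<M. f (2 * a + 1))"
    by (simp flip: lessThan_Suc_atMost)
  \<comment> \<open>At \<open>k = h - j\<close> the second factor is \<open>binom n n = 1\<close>,
    and reflection turns the first into the isolated term.\<close>
  have "(\<Sum>k = 0..int h - int j. binom n (2 * k) * binom n (2 * k + 2 * int j - 1))
      = (\<Sum>k = 0..int h - int j - 1. binom n (2 * k) * binom n (2 * k + 2 * int j - 1))
        + binom n (2 * int j - 1)"
  proof -
    have "{0..int h - int j} = insert (int h - int j) {0..int h - int j - 1}"
      using assms by auto
    moreover have "binom n (2 * (int h - int j)) = binom n (2 * int j - 1)"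
      by (subst binom_symmetric) (simp add: n)
    moreover have "binom n (2 * (int h - int j) + 2 * int j - 1) = 1"
      using n by (simp flip: n)
    ultimately show ?thesis
      by simp
  qed
  then have "- binom n (2 * int j - 1) +
            (\<Sum>k = 0..int h - int j - 1.
               binom n (2 * k + 2 * int j) * binom n (2 * k + 1)
               - binom n (2 * k) * binom n (2 * k + 2 * int j - 1))
      = (\<Sum>a\<le>M. f (2 * a)) - (\<Sum>a<M. f (2 * a + 1))"
    using even_part odd_part by (simp add: sum_subtractf)
  also have "\<dots> = (\<Sum>i\<le>2 * M. (-1) ^ i * f i)"
    by (simp add: sum_alternating_even_odd)
  also have "\<dots> = (\<Sum>i\<le>2 * M. (-1) ^ i * (int (n choose i) * int (n choose (2 * M - i))))"
  proof (rule sum.cong[OF refl])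
    fix i assume "i \<in> {..2 * M}"
    then have "2 * int M - int i = int (2 * M - i)"
      by auto
    then show "(-1) ^ i * f i = (-1) ^ i * (int (n choose i) * int (n choose (2 * M - i)))"
      by (simp only: f_def binom_int)
  qed
  also have "\<dots> = (-1) ^ M * int (n choose M)"
    by (rule alternating_convolution_choose)
  finally have *: "- binom n (2 * int j - 1) +
            (\<Sum>k = 0..int h - int j - 1.
               binom n (2 * k + 2 * int j) * binom n (2 * k + 1)
               - binom n (2 * k) * binom n (2 * k + 2 * int j - 1))
      = (-1) ^ M * int (n choose M)" .
  \<comment> \<open>The prefactor is \<open>(-1) ^ M\<close> as well, so the two signs
    cancel.\<close>
  have "int j + int h - 1 = int M"
    by (simp add: M)
  then show ?thesis
    unfolding * M_def[symmetric] by (simp flip: mult.assoc power_mult_distrib)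
qed

theorem theorem2:
  fixes m :: nat
  assumes "m \<ge> 2" and "even m"
  shows "(\<forall>j::int. 0 \<le> j \<and> j \<le> (int m - 2) div 2 \<longrightarrow>
           (-1) ^ nat (int m div 2 + j - 1) *
             (- binom (m - 1) (2 * j - 1) +
              (\<Sum>k = 0..int m div 2 - j - 1.
                 binom (m - 1) (2 * k + 2 * j) * binom (m - 1) (2 * k + 1)
                 - binom (m - 1) (2 * k) * binom (m - 1) (2 * k + 2 * j - 1)))
           = binom (m - 1) (j + int m div 2 - 1))
       \<and> (-1) ^ (m div 2) *
             (1 - int m +
              (\<Sum>k = 0..int m div 2 - 2.
                 binom (m - 1) (2 * k + 1) *
                 (binom (m - 1) (2 * k + 2) - binom (m - 1) (2 * k))))
           = binom (m - 1) (int m div 2)"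
proof -
  obtain h where h: "m = 2 * h" "h \<ge> 1"
    using assms by (auto elim!: evenE)
  \<comment> \<open>This exhibits \<open>1 - m\<close> as the isolated term for
    \<open>j = 1\<close>.\<close>
  have m1: "1 - int m = - binom (m - 1) 1"
    using h by (simp add: binom_def)
  show ?thesis
  proof (intro conjI allI impI)
    fix j :: int
    assume "0 \<le> j \<and> j \<le> (int m - 2) div 2"
    then obtain j' where j': "j = int j'" "j' \<le> h"
      using h nonneg_int_cases[of j] by auto
    moreover have "nat (int m div 2 + j - 1) = h + j' - 1"
      using h j' by auto
    ultimately show "(-1) ^ nat (int m div 2 + j - 1) *
             (- binom (m - 1) (2 * j - 1) +
              (\<Sum>k = 0..int m div 2 - j - 1.
                 binom (m - 1) (2 * k + 2 * j) * binom (m - 1) (2 * k + 1)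
                 - binom (m - 1) (2 * k) * binom (m - 1) (2 * k + 2 * j - 1)))
           = binom (m - 1) (j + int m div 2 - 1)"
      using binom_product_sum[of h j'] h by simp
  next
    show "(-1) ^ (m div 2) *
             (1 - int m +
              (\<Sum>k = 0..int m div 2 - 2.
                 binom (m - 1) (2 * k + 1) *
                 (binom (m - 1) (2 * k + 2) - binom (m - 1) (2 * k))))
           = binom (m - 1) (int m div 2)"
      unfolding m1 using binom_product_sum[of h 1] h by (simp add: algebra_simps)
  qed
qed

end
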